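(* There exists a $2$-$(66,6,1)$ design (having exactly $143$ blocks) such that: (1) the block graph of the design has exactly $80$ maximum cliques, of which exactly $66$ are canonical and exactly $14$ are non-canonical; (2) none of the $14$ non-canonical maximum cliques has a design structure.
   Context: A $2$-$(n,m,1)$ design is a collection of $m$-subsets (blocks) of an $n$-set (points) such that every pair of distinct points lies in exactly one block. The block graph of such a design has the blocks as vertices, two distinct blocks being adjacent if and only if they intersect. For a $2$-$(n,m,1)$ design that is not symmetric (i.e. has more blocks than points, as here: $143>66$), the maximum clique size of the block graph is $\frac{n-1}{m-1}$ (here $13$). A clique of this size consisting of all blocks containing a fixed point is called canonical; other maximum cliques are non-canonical. A set $C$ of blocks has a design structure if, taking as point set the union $U$ of the blocks in $C$, the blocks of $C$ form a $2$-$(|U|,m,1)$ design on $U$. *)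

theory Defs
  imports "Graph_Theory.Graph_Theory"
begin

text \<open>Since two distinct points lie in a unique block, a \<open>2-(n,m,1)\<close> design (with \<open>m \<ge> 2\<close>) has no
  repeated blocks, so a set of blocks loses nothing over a family of blocks.\<close>

definition design_2_1 :: "nat \<Rightarrow> nat \<Rightarrow> 'a set \<Rightarrow> 'a set set \<Rightarrow> bool" where
  "design_2_1 n m P B \<longleftrightarrow>
     finite P \<and> card P = n \<and>
     (\<forall>b\<in>B. b \<subseteq> P \<and> card b = m) \<and>
     (\<forall>x\<in>P. \<forall>y\<in>P. x \<noteq> y \<longrightarrow> (\<exists>!b. b \<in> B \<and> x \<in> b \<and> y \<in> b))"

definition block_graph :: "'a set set \<Rightarrow> 'a set pair_pre_digraph" where
  "block_graph B =
     \<lparr> pverts = B, parcs = {(b, c). b \<in> B \<and> c \<in> B \<and> b \<noteq> c \<and> b \<inter> c \<noteq> {}} \<rparr>"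

lemma pair_graph_block_graph:
  assumes "finite B"
  shows "pair_graph (block_graph B)"
proof
  have "parcs (block_graph B) \<subseteq> B \<times> B"
    by (auto simp: block_graph_def)
  then show "finite (parcs (block_graph B))"
    using assms by (meson finite_SigmaI finite_subset)
  show "symmetric (with_proj (block_graph B))"
    by (auto simp: symmetric_def block_graph_def sym_def)
qed (use assms in \<open>auto simp: block_graph_def\<close>)

definition clique :: "('a, 'b) pre_digraph \<Rightarrow> 'a set \<Rightarrow> bool" where
  "clique G K \<longleftrightarrow> K \<subseteq> verts G \<and> (\<forall>u\<in>K. \<forall>v\<in>K. u \<noteq> v \<longrightarrow> u \<rightarrow>\<^bsub>G\<^esub> v)"

text \<open>Maximum means of largest cardinality, not merely maximal under inclusion. Finiteness is explicit
  because \<^const>\<open>card\<close> is \<open>0\<close> on infinite sets; it is automatic for finite graphs.\<close>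

definition maximum_clique :: "('a, 'b) pre_digraph \<Rightarrow> 'a set \<Rightarrow> bool" where
  "maximum_clique G K \<longleftrightarrow>
     clique G K \<and> finite K \<and> (\<forall>K'. clique G K' \<longrightarrow> finite K' \<and> card K' \<le> card K)"

definition canonical_clique :: "'a set \<Rightarrow> 'a set set \<Rightarrow> 'a set set \<Rightarrow> bool" where
  "canonical_clique P B K \<longleftrightarrow>
     maximum_clique (block_graph B) K \<and> (\<exists>x\<in>P. K = {b \<in> B. x \<in> b})"

definition non_canonical_clique :: "'a set \<Rightarrow> 'a set set \<Rightarrow> 'a set set \<Rightarrow> bool" where
  "non_canonical_clique P B K \<longleftrightarrow>
     maximum_clique (block_graph B) K \<and> \<not> canonical_clique P B K"

definition has_design_structure :: "nat \<Rightarrow> 'a set set \<Rightarrow> bool" where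
  "has_design_structure m C \<longleftrightarrow> design_2_1 (card (\<Union>C)) m (\<Union>C) C"

end

theory Submission
  imports Defs
begin

text \<open>For a clique \<open>K\<close> with at least 13 blocks, let the degree of a point be the number of blocks of \<open>K\<close>
  through it. A degree above 6 forces \<open>K\<close> to consist of all blocks through that point, and the degrees
  along a block of \<open>K\<close> add up to \<open>card K + 5 \<ge> 18\<close>. So either some degree lies between 4 and 6, or
  \<open>card K = 13\<close> and every degree is 0 or 3. If a point has degree \<open>k\<close>, then all but \<open>k\<close> blocks of \<open>K\<close> are among
  the common neighbours of \<open>k\<close> blocks through that point, and these are few. Hence it suffices to run
  through the sets of 3 to 6 blocks at one point of each orbit under an automorphism of order 13.
  No non-canonical clique has a design structure because 13 blocks of size 6 never form a design.\<close>

section \<open>Cliques in block graphs of designs\<close>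

lemma clique_block_graph_iff:
  "clique (block_graph B) K \<longleftrightarrow> K \<subseteq> B \<and> (\<forall>b\<in>K. \<forall>c\<in>K. b \<noteq> c \<longrightarrow> b \<inter> c \<noteq> {})"
  by (auto simp: clique_def block_graph_def arcs_ends_def arc_to_ends_def)

lemma design_block:
  assumes "design_2_1 n m P B" "b \<in> B"
  shows "finite b" "card b = m" "b \<subseteq> P"
proof -
  have "finite P" "b \<subseteq> P" "card b = m"
    using assms by (simp_all add: design_2_1_def)
  then show "finite b" "card b = m" "b \<subseteq> P"
    by (simp_all add: finite_subset[of b P])
qed

lemma design_finite:
  assumes "design_2_1 n m P B"
  shows "finite P" "finite B"
proof -
  show "finite P"
    using assms by (simp add: design_2_1_def)
  then show "finite B"
    using design_block(3)[OF assms] by (auto intro: finite_subset[of B "Pow P"])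
qed

text \<open>Double counting of the pairs \<open>(y, b)\<close> with \<open>y \<noteq> x\<close> and
  both points on \<open>b\<close>: each \<open>y\<close> occurs in one pair, each block through
  \<open>x\<close> in \<open>m - 1\<close> pairs.\<close>

lemma design_replication:
  assumes D: "design_2_1 n m P B" and x: "x \<in> P"
  shows "card {b \<in> B. x \<in> b} * (m - 1) = n - 1"
proof -
  note fin = design_finite[OF D] and block = design_block[OF D]
  have one: "card {b \<in> {b \<in> B. x \<in> b}. y \<in> b} = 1" if "y \<in> P - {x}" for y
  proof -
    have "\<exists>!b. b \<in> B \<and> x \<in> b \<and> y \<in> b"
      using D x that unfolding design_2_1_def by blast
    then obtain b where "{b \<in> B. x \<in> b \<and> y \<in> b} = {b}"
      by blast
    then show ?thesis
      by simp
  qed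
  have "(\<Sum>b\<in>{b \<in> B. x \<in> b}. card {y \<in> P - {x}. y \<in> b}) = (\<Sum>y\<in>P - {x}. 1)"
    using fin one by (intro sum_multicount_gen) auto
  moreover have "card {y \<in> P - {x}. y \<in> b} = m - 1" if "b \<in> B" "x \<in> b" for b
  proof -
    have "{y \<in> P - {x}. y \<in> b} = b - {x}"
      using block that by auto
    then show ?thesis
      using block that by (simp add: card_Diff_singleton)
  qed
  moreover have "card (P - {x}) = n - 1"
    using D x by (simp add: design_2_1_def)
  ultimately show ?thesis
    by simp
qed

lemma design_flag_count:
  assumes D: "design_2_1 n m P B"
  shows "card B * m = (\<Sum>x\<in>P. card {b \<in> B. x \<in> b})"
proof -
  note fin = design_finite[OF D] and block = design_block[OF D]
  have "card {x \<in> P. x \<in> b} = m" if "b \<in> B" for b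
  proof -
    have "{x \<in> P. x \<in> b} = b"
      using block that by auto
    then show ?thesis
      using block that by simp
  qed
  then have "(\<Sum>x\<in>P. card {b \<in> B. x \<in> b}) = (\<Sum>b\<in>B. m)"
    using fin by (intro sum_multicount_gen) auto
  then show ?thesis
    by simp
qed

text \<open>With \<open>v\<close> points and \<open>k\<close> blocks through each point, replication
  gives v = 5k + 1 and counting flags gives vk = 78. But (5k + 1)k jumps from 48 at k = 3 to 84 at k
  = 4.\<close>

lemma no_design_with_13_blocks:
  assumes "card C = 13"
  shows "\<not> has_design_structure 6 C"
proof
  assume "has_design_structure 6 C"
  then have D: "design_2_1 (card (\<Union>C)) 6 (\<Union>C) C"
    by (simp add: has_design_structure_def)
  define v where "v = card (\<Union>C)"
  have r: "card {b \<in> C. x \<in> b} * 5 = v - 1" if "x \<in> \<Union>C" for x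
    using design_replication[OF D that] by (simp add: v_def)
  have "13 * 6 = (\<Sum>x\<in>\<Union>C. card {b \<in> C. x \<in> b})"
    using design_flag_count[OF D] assms by simp
  \<comment> \<open>All points have the same degree; the quotient expresses it without reference to
    \<open>x\<close>.\<close>
  also have "\<dots> = (\<Sum>x\<in>\<Union>C. (v - 1) div 5)"
  proof (rule sum.cong[OF refl])
    fix x
    assume "x \<in> \<Union>C"
    then have "v - 1 = card {b \<in> C. x \<in> b} * 5"
      by (rule r[symmetric])
    then show "card {b \<in> C. x \<in> b} = (v - 1) div 5"
      by (simp only: nonzero_mult_div_cancel_right zero_neq_numeral[symmetric] not_False_eq_True)
  qed
  finally have eq: "v * ((v - 1) div 5) = 78"
    by (simp add: v_def)
  then have "\<Union>C \<noteq> {}"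
    unfolding v_def by (intro notI) (simp only: card.empty mult_0 zero_neq_numeral)
  then obtain x where "x \<in> \<Union>C"
    by blast
  define k where "k = card {b \<in> C. x \<in> b}"
  have k: "v - 1 = k * 5"
    using r[OF \<open>x \<in> \<Union>C\<close>] by (simp add: k_def)
  \<comment> \<open>Otherwise the truncated \<open>v - 1\<close> would not determine
    \<open>v\<close>.\<close>
  have "v \<noteq> 0"
    using eq by (intro notI) simp
  with k have "v = 5 * k + 1"
    by simp
  with eq have vk: "(5 * k + 1) * k = 78"
    by simp
  have "k \<le> 3 \<or> 4 \<le> k"
    by auto
  then show False
  proof
    assume "k \<le> 3"
    then have "(5 * k + 1) * k \<le> (5 * 3 + 1) * 3"
      by (intro mult_mono) auto
    with vk show False
      by simp
  next
    assume "4 \<le> k"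
    then have "(5 * 4 + 1) * 4 \<le> (5 * k + 1) * k"
      by (intro mult_mono) auto
    with vk show False
      by simp
  qed
qed

section \<open>Degrees of points in a clique\<close>

lemma design_block_inter:
  assumes D: "design_2_1 n m P B"
    and bc: "b \<in> B" "c \<in> B" "b \<noteq> c" "x \<in> b" "x \<in> c" "y \<in> b" "y \<in> c"
  shows "x = y"
proof (rule ccontr)
  assume "x \<noteq> y"
  moreover have "x \<in> P" "y \<in> P"
    using design_block(3)[OF D bc(1)] bc by auto
  ultimately have "\<exists>!b. b \<in> B \<and> x \<in> b \<and> y \<in> b"
    using D unfolding design_2_1_def by blast
  then show False
    using bc by blast
qed

text \<open>Every other block of \<open>K\<close> meets \<open>b\<close> in exactly one point and so
  adds 1 to the sum, while \<open>b\<close> itself adds \<open>m\<close>.\<close>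

lemma clique_degree_sum:
  assumes D: "design_2_1 n m P B" and K: "clique (block_graph B) K" "finite K" and b: "b \<in> K"
  shows "(\<Sum>p\<in>b. card {c \<in> K. p \<in> c}) = m + card K - 1"
proof -
  have sub: "K \<subseteq> B" and meet: "\<And>c. c \<in> K \<Longrightarrow> c \<noteq> b \<Longrightarrow> b \<inter> c \<noteq> {}"
    using K b by (auto simp: clique_block_graph_iff)
  have fb: "finite b" "card b = m"
    using design_block[OF D] sub b by blast+
  have one: "card {p \<in> b. p \<in> c} = 1" if "c \<in> K - {b}" for c
  proof -
    have "b \<inter> c \<noteq> {}"
      using meet that by auto
    then obtain p where p: "p \<in> b" "p \<in> c"
      by blast
    then have "{q \<in> b. q \<in> c} = {p}"
      using design_block_inter[OF D, of b c] b that sub by blast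
    then show ?thesis
      by simp
  qed
  have "(\<Sum>p\<in>b. card {c \<in> K. p \<in> c}) = (\<Sum>c\<in>K. card {p \<in> b. p \<in> c})"
    using fb K by (intro sum_multicount_gen) auto
  also have "\<dots> = card {p \<in> b. p \<in> b} + (\<Sum>c\<in>K - {b}. 1)"
    using K b one by (simp add: sum.remove)
  also have "\<dots> = m + card K - 1"
    using K b fb card_gt_0_iff[of K] by (auto simp: card_Diff_singleton)
  finally show ?thesis .
qed

text \<open>A block \<open>b\<close> of \<open>K\<close> off \<open>p\<close> would meet the blocks
  of \<open>K\<close> through \<open>p\<close> in distinct points, since any two of those share only
  \<open>p\<close>. Hence there would be at most \<open>m\<close> of them.\<close>

lemma clique_degree_gt_imp_pencil:
  assumes D: "design_2_1 n m P B" and K: "clique (block_graph B) K" "finite K"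
    and large: "m < card {c \<in> K. p \<in> c}"
  shows "K \<subseteq> {b \<in> B. p \<in> b}"
proof (rule ccontr)
  assume "\<not> ?thesis"
  then obtain b where b: "b \<in> K" "p \<notin> b"
    using K by (auto simp: clique_block_graph_iff)
  have sub: "K \<subseteq> B" and meet: "\<And>c. c \<in> K \<Longrightarrow> c \<noteq> b \<Longrightarrow> b \<inter> c \<noteq> {}"
    using K b by (auto simp: clique_block_graph_iff)
  have fb: "finite b" "card b = m"
    using design_block[OF D] sub b by blast+
  define f where "f c = (SOME q. q \<in> b \<inter> c)" for c
  have f: "f c \<in> b \<inter> c" if "c \<in> K" "p \<in> c" for c
  proof -
    have "\<exists>q. q \<in> b \<inter> c"
      using meet that b by blast
    then show ?thesis
      unfolding f_def by (rule someI_ex)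
  qed
  have "inj_on f {c \<in> K. p \<in> c}"
  proof (rule inj_onI, rule ccontr)
    fix c d
    assume *: "c \<in> {c \<in> K. p \<in> c}" "d \<in> {c \<in> K. p \<in> c}" "f c = f d" "c \<noteq> d"
    then have "f c = p"
      using f design_block_inter[OF D, of c d "f c" p] sub by fastforce
    then show False
      using f[of c] * b by auto
  qed
  then have "card {c \<in> K. p \<in> c} \<le> card b"
    using f fb by (intro card_inj_on_le[of f]) auto
  then show False
    using large fb by simp
qed

section \<open>Exhaustive search\<close>

text \<open>Inspects at most \<open>n\<close> entries, so that evaluation never has to compute a
  whole length.\<close>

fun at_least :: "nat \<Rightarrow> 'a list \<Rightarrow> bool" where
  "at_least 0 xs = True" |
  "at_least (Suc n) [] = False" |
  "at_least (Suc n) (x # xs) = at_least n xs"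

lemma at_least_iff: "at_least n xs \<longleftrightarrow> n \<le> length xs"
  by (induction n xs rule: at_least.induct) auto

text \<open>Prunes a branch: on an empty candidate list \<open>search\<close> stops without a
  result.\<close>

definition trim :: "nat \<Rightarrow> 'a list \<Rightarrow> 'a list" where
  "trim m xs = (if at_least m xs then xs else [])"

text \<open>A pair \<open>(d, ts)\<close> stands for a candidate \<open>d\<close> together with its adjacencies \<open>ts\<close> to the vertices that
  the search has yet to consider, so that no adjacency is computed twice.\<close>

definition traces :: "('a \<Rightarrow> 'a \<Rightarrow> bool) \<Rightarrow> 'a list \<Rightarrow> 'a list \<Rightarrow> ('a \<times> bool list) list" where
  "traces R vs ds = map (\<lambda>d. (d, map (R d) vs)) ds"

definition skip :: "('a \<times> bool list) list \<Rightarrow> ('a \<times> bool list) list" where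
  "skip = map (map_prod id tl)"

fun keep :: "('a \<times> bool list) list \<Rightarrow> ('a \<times> bool list) list" where
  "keep [] = []" |
  "keep ((d, ts) # ds) = (if hd ts then [(d, tl ts)] else []) @ keep ds"

text \<open>\<open>acc\<close> holds the vertices chosen so far, and \<open>k\<close> more are to be
  chosen from \<open>vs\<close>. Started on \<open>traces\<close>, the last argument carries the
  candidates adjacent to all vertices chosen since. A result pairs a choice with its common
  neighbours.\<close>

fun search :: "nat \<Rightarrow> nat \<Rightarrow> 'a list \<Rightarrow> 'a list \<Rightarrow> ('a \<times> bool list) list \<Rightarrow> ('a list \<times> 'a list) list" where
  "search m k acc vs [] = []" |
  "search m 0 acc vs (d # ds) = [(acc, map fst (d # ds))]" |
  "search m (Suc k) acc [] (d # ds) = []" |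
  "search m (Suc k) acc (v # vs) (d # ds) =
     search m k (v # acc) vs (trim m (keep (d # ds))) @
     search m (Suc k) acc vs (skip (d # ds))"

lemma keep_traces: "keep (traces R (v # vs) ds) = traces R vs (filter (\<lambda>d. R d v) ds)"
  by (induction ds) (auto simp: traces_def)

lemma skip_traces: "skip (traces R (v # vs) ds) = traces R vs ds"
  by (simp add: skip_def traces_def)

lemma fst_traces: "map fst (traces R vs ds) = ds"
  by (simp add: traces_def comp_def)

text \<open>Follow the branch that chooses exactly the elements of \<open>T\<close>. All of
  \<open>E\<close> survives each \<open>keep\<close> along it, being adjacent to the chosen vertex,
  so at least \<open>m\<close> candidates remain and \<open>trim\<close> never cuts. Since
  \<open>0 < m\<close>, the candidate list is never empty.\<close>

lemma search_complete:
  assumes "T \<subseteq> set vs" "card T = k" "E \<subseteq> set ds" "0 < m" "m \<le> card E"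
    and "\<And>t e. t \<in> T \<Longrightarrow> e \<in> E \<Longrightarrow> R e t"
  shows "\<exists>a F. (a, F) \<in> set (search m k acc vs (traces R vs ds)) \<and> set a = T \<union> set acc \<and> E \<subseteq> set F"
  using assms
proof (induction vs arbitrary: T k acc ds)
  case Nil
  then have "ds \<noteq> []" "T = {}" "k = 0"
    by auto
  then obtain x xs where "traces R [] ds = x # xs" "map fst (x # xs) = ds"
    by (metis fst_traces list.exhaust list.simps(8))
  then show ?case
    using Nil \<open>T = {}\<close> \<open>k = 0\<close> by auto
next
  case (Cons v vs)
  then have "ds \<noteq> []"
    by auto
  then obtain x xs where xs: "traces R (v # vs) ds = x # xs" "map fst (x # xs) = ds"
    by (metis fst_traces list.exhaust list.simps(8))
  show ?case
  proof (cases k)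
    case 0
    moreover have "finite T"
      using Cons.prems(1) by (rule finite_subset) simp
    ultimately have "T = {}"
      using Cons.prems(2) by simp
    then show ?thesis
      using 0 Cons.prems xs by auto
  next
    case (Suc j)
    show ?thesis
    proof (cases "v \<in> T")
      case True
      let ?ds = "filter (\<lambda>d. R d v) ds"
      have E: "E \<subseteq> set ?ds"
        using Cons.prems(3,6) True by auto
      have "m \<le> length (keep (x # xs))"
        using Cons.prems(5) card_mono[OF _ E] card_length[of ?ds]
        by (simp add: keep_traces flip: xs(1)) (simp add: traces_def)
      then have trim: "trim m (keep (x # xs)) = traces R vs ?ds"
        by (simp add: trim_def at_least_iff keep_traces flip: xs(1))
      have "\<exists>a F. (a, F) \<in> set (search m j (v # acc) vs (traces R vs ?ds)) \<and>
          set a = (T - {v}) \<union> set (v # acc) \<and> E \<subseteq> set F"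
        using Cons.prems True E Suc by (intro Cons.IH) (auto simp: card_Diff_singleton)
      then show ?thesis
        using True Suc trim by (fastforce simp: xs(1))
    next
      case False
      have "\<exists>a F. (a, F) \<in> set (search m k acc vs (traces R vs ds)) \<and> set a = T \<union> set acc \<and> E \<subseteq> set F"
        using Cons.prems False by (intro Cons.IH) auto
      moreover have "skip (x # xs) = traces R vs ds"
        by (simp add: skip_traces flip: xs(1))
      ultimately show ?thesis
        using Suc by (fastforce simp: xs(1))
    qed
  qed
qed

section \<open>The design and its translations\<close>

text \<open>The point \<open>13 * a + x\<close> with \<open>x < 13\<close> stands for the element \<open>x\<close> of the \<open>a\<close>-th of five copies of
  the integers modulo 13, and 65 for a point at infinity. The blocks are the translates of eleven base
  blocks, which were found by a computer search for designs that are moreover invariant under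
  multiplication by 3 combined with a cyclic permutation of the first three copies.\<close>

definition translate :: "nat \<Rightarrow> nat \<Rightarrow> nat" where
  "translate i p = (if p = 65 then 65 else 13 * (p div 13) + (p + i) mod 13)"

definition base_blocks :: "nat list list" where
  "base_blocks = [[0, 13, 26, 39, 52, 65], [40, 42, 48, 54, 57, 58],
     [0, 1, 8, 36, 59, 61], [4, 13, 16, 24, 53, 60], [25, 26, 33, 35, 55, 63],
     [0, 2, 18, 19, 47, 51], [13, 19, 28, 31, 49, 50], [2, 6, 26, 31, 43, 46],
     [0, 3, 24, 30, 46, 57], [12, 13, 22, 33, 47, 54], [8, 23, 26, 27, 50, 58]]"

definition blocks :: "nat list list" where
  "blocks = concat (map (\<lambda>b. map (\<lambda>i. map (translate i) b) [0..<13]) base_blocks)"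

text \<open>Base block 1 consists of the residues 1, 3, 9 in the fourth copy and 2, 5, 6 in the
  fifth. Each nonzero residue modulo 13 is exactly once a difference within one of these triples, so
  any two translates meet. Every point of these two copies has degree 3.\<close>

definition orbit_clique :: "nat list list" where
  "orbit_clique = map (\<lambda>i. map (translate i) (base_blocks ! 1)) [0..<13]"

text \<open>A pair is the index of a base block and a shift. Four pairs use base block 0, the only
  one through the point at infinity, which therefore has degree 4 in this clique and its
  translates.\<close>

definition mixed_clique :: "nat list list" where
  "mixed_clique = map (\<lambda>(k, i). map (translate i) (base_blocks ! k))
     [(0, 0), (0, 2), (0, 5), (0, 6), (2, 5), (3, 2), (4, 6), (5, 0), (6, 0), (7, 0), (8, 2), (9, 6), (10, 5)]"

text \<open>\<open>orbit_clique\<close> comes first, so that \<open>hd cliques\<close> denotes it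
  below.\<close>

definition cliques :: "nat list list list" where
  "cliques = orbit_clique # map (\<lambda>i. map (map (translate i)) mixed_clique) [0..<13]"

definition lines :: "nat set set" where
  "lines = set ` set blocks"

definition exceptional :: "nat set set set" where
  "exceptional = (\<lambda>C. set ` set C) ` set cliques"

section \<open>The action of the translations on points, lines and exceptional cliques\<close>

lemma translate_less:
  assumes "p < 66"
  shows "translate i p < 66"
proof (cases "p = 65")
  case False
  then have "p div 13 < 5"
    using assms by (simp add: less_mult_imp_div_less)
  moreover have "(p + i) mod 13 < 13"
    by simp
  ultimately show ?thesis
    using False by (simp add: translate_def)
qed (simp add: translate_def)

lemma translate_translate:
  assumes "p < 66"
  shows "translate i (translate j p) = translate (i + j) p"
proof (cases "p = 65")
  case False
  then have "p div 13 < 5"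
    using assms by (simp add: less_mult_imp_div_less)
  moreover have "(p + j) mod 13 < 13"
    by simp
  ultimately have "translate j p \<noteq> 65"
    using False by (simp add: translate_def)
  moreover have "translate j p div 13 = p div 13" "translate j p mod 13 = (p + j) mod 13"
    using False by (simp_all add: translate_def)
  moreover have "(translate j p + i) mod 13 = ((p + j) mod 13 + i) mod 13"
    using calculation(3) by (metis mod_add_left_eq)
  ultimately show ?thesis
    using False by (simp add: translate_def mod_simps ac_simps)
qed (simp add: translate_def)

lemma translate_mod: "translate (i mod 13) = translate i"
  by (simp add: translate_def fun_eq_iff mod_simps)

lemma translate_multiple: "p < 66 \<Longrightarrow> translate (13 * i) p = p"
  by (simp add: translate_def)

text \<open>The inverse shift is written \<open>12 * i\<close> because \<open>i + 12 * i\<close> is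
  a multiple of 13; this avoids negative shifts.\<close>

lemma translate_inverse:
  assumes "p < 66"
  shows "translate (12 * i) (translate i p) = p"
  using assms translate_multiple[of p i] by (simp add: translate_translate)

lemma inj_on_translate: "inj_on (translate i) {..<66}"
  using translate_inverse by (intro inj_on_inverseI[where g = "translate (12 * i)"]) auto

lemma image_translate_translate:
  assumes "b \<subseteq> {..<66}"
  shows "translate i ` translate j ` b = translate (i + j) ` b"
  using assms by (auto simp: image_image translate_translate intro!: image_cong)

lemma image_translate_inverse:
  assumes "b \<subseteq> {..<66}"
  shows "translate (12 * i) ` translate i ` b = b"
proof -
  have "translate (13 * i) p = p" if "p \<in> b" for p
    using assms that by (intro translate_multiple) auto
  then have "translate (13 * i) ` b = b"
    by (simp cong: image_cong)
  then show ?thesis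
    using assms by (simp add: image_translate_translate)
qed

lemma base_blocks_props:
  "list_all (\<lambda>b. list_all (\<lambda>p. p < 66) b \<and> distinct b \<and> length b = 6) base_blocks"
  by (simp add: base_blocks_def)

lemma base_block:
  assumes "b \<in> set base_blocks"
  shows "set b \<subseteq> {..<66}" "card (set b) = 6"
  using base_blocks_props assms by (auto simp: list_all_iff distinct_card)

lemma translate_base_block:
  "c \<in> set base_blocks \<Longrightarrow> i < 13 \<Longrightarrow> map (translate i) c \<in> set blocks"
  by (force simp: blocks_def)

text \<open>Letting \<open>i\<close> range over all natural numbers makes closure under translation
  a matter of adding shifts.\<close>

lemma lines_iff: "b \<in> lines \<longleftrightarrow> (\<exists>c\<in>set base_blocks. \<exists>i. b = translate i ` set c)"
proof
  assume "\<exists>c\<in>set base_blocks. \<exists>i. b = translate i ` set c"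
  then obtain c i where c: "c \<in> set base_blocks" and b: "b = set (map (translate (i mod 13)) c)"
    by (auto simp: translate_mod)
  have "map (translate (i mod 13)) c \<in> set blocks"
    using c by (simp add: translate_base_block)
  with b show "b \<in> lines"
    unfolding lines_def by (rule image_eqI)
next
  assume "b \<in> lines"
  then show "\<exists>c\<in>set base_blocks. \<exists>i. b = translate i ` set c"
    by (fastforce simp: lines_def blocks_def)
qed

lemma line:
  assumes "b \<in> lines"
  shows "b \<subseteq> {..<66}" "card b = 6"
proof -
  obtain c i where c: "c \<in> set base_blocks" and b: "b = translate i ` set c"
    using assms by (auto simp: lines_iff)
  show "b \<subseteq> {..<66}"
    using base_block[OF c] translate_less by (auto simp: b)
  show "card b = 6"
    using base_block[OF c] inj_on_subset[OF inj_on_translate] by (simp add: b card_image)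
qed

lemma translate_line:
  assumes "b \<in> lines"
  shows "translate i ` b \<in> lines"
proof -
  obtain c j where c: "c \<in> set base_blocks" and b: "b = translate j ` set c"
    using assms by (auto simp: lines_iff)
  have "translate i ` b = translate (i + j) ` set c"
    using base_block(1)[OF c] by (simp add: b image_translate_translate)
  then show ?thesis
    using c by (auto simp: lines_iff)
qed

lemma mixed_clique_subset: "set mixed_clique \<subseteq> set blocks"
proof -
  have "length base_blocks = 11"
    by (simp add: base_blocks_def)
  then show ?thesis
    unfolding mixed_clique_def by (auto intro!: translate_base_block nth_mem)
qed

lemma exceptional_alt:
  "exceptional = insert (range (\<lambda>i. translate i ` set (base_blocks ! 1)))
     (range (\<lambda>i. image (translate i) ` set ` set mixed_clique))"
proof -
  have mod: "range (\<lambda>i. f (translate i)) = (\<lambda>i. f (translate i)) ` {0..<13}"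
    for f :: "(nat \<Rightarrow> nat) \<Rightarrow> 'a"
  proof -
    have "f (translate i) \<in> (\<lambda>i. f (translate i)) ` {0..<13}" for i
      by (intro image_eqI[of _ _ "i mod 13"]) (simp_all add: translate_mod)
    then show ?thesis
      by blast
  qed
  have "set ` set orbit_clique = range (\<lambda>i. translate i ` set (base_blocks ! 1))"
    unfolding mod[of "\<lambda>t. t ` set (base_blocks ! 1)"]
    by (simp add: orbit_clique_def image_image)
  moreover have "(\<lambda>C. set ` set C) ` set (map (\<lambda>i. map (map (translate i)) mixed_clique) [0..<13]) =
      range (\<lambda>i. image (translate i) ` set ` set mixed_clique)"
    unfolding mod[of "\<lambda>t. image t ` set ` set mixed_clique"]
    by (simp add: image_image)
  ultimately show ?thesis
    by (simp add: exceptional_def cliques_def)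
qed

text \<open>A translation maps the orbit clique to itself and permutes the translates of the mixed
  clique.\<close>

lemma translate_exceptional:
  assumes "K \<in> exceptional"
  shows "image (translate i) ` K \<in> exceptional"
  using assms unfolding exceptional_alt
proof (elim insertE)
  define b where "b = set (base_blocks ! 1)"
  have b: "b \<subseteq> {..<66}"
    using base_block(1) by (simp add: b_def base_blocks_def)
  assume "K = range (\<lambda>i. translate i ` set (base_blocks ! 1))"
  then have K: "K = range (\<lambda>i. translate i ` b)"
    by (simp add: b_def)
  have "translate j ` b \<in> image (translate i) ` K" for j
  proof -
    \<comment> \<open>The total shift \<open>i + (12 * i + j)\<close> is congruent to
      \<open>j\<close> modulo 13.\<close>
    have "translate j ` b = translate i ` translate (12 * i + j) ` b"
      using b translate_mod[of "i + (12 * i + j)"] translate_mod[of j]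
      by (simp add: image_translate_translate mod_simps)
    then show ?thesis
      by (auto simp: K)
  qed
  then have "image (translate i) ` K = K"
    using b by (auto simp: K image_translate_translate)
  then show "image (translate i) ` K \<in> insert (range (\<lambda>i. translate i ` set (base_blocks ! 1)))
      (range (\<lambda>i. image (translate i) ` set ` set mixed_clique))"
    by (simp add: K b_def)
next
  assume "K \<in> range (\<lambda>i. image (translate i) ` set ` set mixed_clique)"
  then obtain j where K: "K = image (translate j) ` set ` set mixed_clique"
    by blast
  have "set c \<subseteq> {..<66}" if "c \<in> set mixed_clique" for c
    using that mixed_clique_subset line(1) by (auto simp: lines_def)
  then have "image (translate i) ` K = image (translate (i + j)) ` set ` set mixed_clique"
    unfolding K by (simp add: image_image[of "image _"] image_translate_translate cong: image_cong)
  then show "image (translate i) ` K \<in> insert (range (\<lambda>i. translate i ` set (base_blocks ! 1)))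
      (range (\<lambda>i. image (translate i) ` set ` set mixed_clique))"
    by blast
qed

section \<open>Evaluation\<close>

definition meet :: "nat list \<Rightarrow> nat list \<Rightarrow> bool" where
  "meet b c \<longleftrightarrow> set b \<inter> set c \<noteq> {}"

definition candidates :: "nat \<Rightarrow> nat \<Rightarrow> nat \<Rightarrow> (nat list list \<times> nat list list) list" where
  "candidates m k p = search m k [] (filter (\<lambda>b. p \<in> set b) blocks)
     (traces meet (filter (\<lambda>b. p \<in> set b) blocks) (filter (\<lambda>b. p \<notin> set b) blocks))"

definition core :: "nat \<Rightarrow> nat list list \<Rightarrow> nat list list" where
  "core m F = filter (\<lambda>f. at_least m (filter (meet f) F)) F"

text \<open>If \<open>T\<close> consists of all blocks of \<open>K\<close> through a point and \<open>E\<close> of the others, with \<open>card E \<ge> m\<close> and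
  \<open>E \<subseteq> F\<close>, then every block in \<open>E\<close> meets at least \<open>m\<close> blocks in \<open>F\<close> (itself included), that is
  \<open>E \<subseteq> core m F\<close>.\<close>

fun spans_exceptional :: "nat \<Rightarrow> nat list list \<times> nat list list \<Rightarrow> bool" where
  "spans_exceptional m (T, F) \<longleftrightarrow> \<not> at_least m (core m F) \<or>
     \<not> at_least (Suc m) (core m F) \<and>
     list_ex (\<lambda>C. list_all (\<lambda>b. b \<in> set C) (T @ core m F)) cliques"

text \<open>When all degrees are 0 or 3, a point \<open>q \<noteq> p\<close> on one of the three blocks through \<open>p\<close> lies on two
  further blocks, and these do not contain \<open>p\<close>.\<close>

fun starved :: "nat \<Rightarrow> nat list list \<times> nat list list \<Rightarrow> bool" where
  "starved p (T, F) \<longleftrightarrow>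
     list_ex (list_ex (\<lambda>q. q \<noteq> p \<and> \<not> at_least 2 (filter (\<lambda>b. q \<in> set b) F))) T"

definition covered_once :: "nat list list \<Rightarrow> nat \<Rightarrow> bool" where
  "covered_once bs q \<longleftrightarrow> at_least 1 (filter (\<lambda>b. q \<in> set b) bs) \<and>
     \<not> at_least 2 (filter (\<lambda>b. q \<in> set b) bs)"

definition good_point :: "nat \<Rightarrow> bool" where
  "good_point p \<longleftrightarrow>
     list_all (\<lambda>q. q = p \<or> covered_once (filter (\<lambda>b. p \<in> set b) blocks) q) [0..<66]"

section \<open>Rewrite rules for the evaluation\<close>

lemma upt_13: "[0..<13] = [0, 1, 2, 3, 4, 5, 6, 7, 8, 9, 10, 11, 12]"
  by (simp add: upt_rec)

lemma upt_66: "[0..<66] = [0, 1, 2, 3, 4, 5, 6, 7, 8, 9, 10, 11, 12, 13, 14, 15, 16, 17, 18, 19, 20,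
  21, 22, 23, 24, 25, 26, 27, 28, 29, 30, 31, 32, 33, 34, 35, 36, 37, 38, 39, 40, 41, 42, 43, 44, 45,
  46, 47, 48, 49, 50, 51, 52, 53, 54, 55, 56, 57, 58, 59, 60, 61, 62, 63, 64, 65]"
  by (simp add: upt_rec)

\<comment> \<open>The unknown is instantiated by the computed literal list, so later checks do not
  repeat the arithmetic modulo 13.\<close>
schematic_goal blocks_unfold: "blocks = ?bs"
  unfolding blocks_def base_blocks_def upt_13 list.map concat.simps append.simps
  by (simp add: translate_def del: One_nat_def)

schematic_goal cliques_unfold: "cliques = ?cs"
  unfolding cliques_def orbit_clique_def mixed_clique_def base_blocks_def upt_13 list.map prod.case
  by (simp add: translate_def del: One_nat_def)

text \<open>The evaluation below uses the simplifier without congruence rules, which rewrites both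
  branches of a conditional. Hence no recursive call may occur below a conditional.\<close>

lemma filter_unfold:
  "filter P [] = []"
  "filter P (x # xs) = (if P x then [x] else []) @ filter P xs"
  by auto

lemma meet_unfold: "meet [] c = False" "meet (x # xs) c = (x \<in> set c \<or> meet xs c)"
  by (auto simp: meet_def)

lemma list_all_ex_unfold:
  "list_all P [] = True" "list_all P (x # xs) = (P x \<and> list_all P xs)"
  "list_ex P [] = False" "list_ex P (x # xs) = (P x \<or> list_ex P xs)"
  by simp_all

lemma sorted_wrt_unfold:
  "sorted_wrt R [] = True"
  "sorted_wrt R (x # xs) = (list_all (R x) xs \<and> sorted_wrt R xs)"
  by (auto simp: list_all_iff)

text \<open>A literal does not match the pattern \<open>Suc n\<close>, so the recursion is restated
  with \<open>pred_numeral\<close>; likewise for \<open>search\<close> below.\<close>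

lemma at_least_unfold:
  "at_least 1 [] = False" "at_least (numeral n) [] = False"
  "at_least 1 (x # xs) = True" "at_least (numeral n) (x # xs) = at_least (pred_numeral n) xs"
  by (simp_all add: numeral_eq_Suc)

lemma search_unfold:
  "search m 1 acc [] (d # ds) = []"
  "search m 1 acc (v # vs) (d # ds) =
     search m 0 (v # acc) vs (trim m (keep (d # ds))) @ search m 1 acc vs (skip (d # ds))"
  "search m (numeral n) acc [] (d # ds) = []"
  "search m (numeral n) acc (v # vs) (d # ds) =
     search m (pred_numeral n) (v # acc) vs (trim m (keep (d # ds))) @
     search m (numeral n) acc vs (skip (d # ds))"
  by (simp_all add: numeral_eq_Suc)

text \<open>Folding \<open>Suc 0\<close> and \<open>Suc 1\<close> to \<open>1\<close> and
  \<open>2\<close> keeps the points literals, on which the numeral rules decide equality.\<close>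

lemmas evaluate =
  blocks_unfold [unfolded One_nat_def [symmetric] Suc_1]
  cliques_unfold [unfolded One_nat_def [symmetric] Suc_1]
  upt_66 filter_unfold meet_unfold list_all_ex_unfold sorted_wrt_unfold
  at_least.simps at_least_unfold search.simps search_unfold keep.simps trim_def skip_def traces_def
  candidates_def core_def spans_exceptional.simps starved.simps covered_once_def good_point_def
  list.set list.sel list.map list.inject list.distinct append.simps
  insert_iff empty_iff if_True if_False simp_thms fst_conv map_prod_simp id_apply
  numeral_eq_iff num.inject num.distinct zero_neq_numeral numeral_neq_zero zero_neq_one one_neq_zero
  numeral_eq_one_iff one_eq_numeral_iff pred_numeral_simps BitM.simps numeral_One
  less_numeral_simps less_num_simps le_num_simps zero_less_one

section \<open>The finite checks\<close>

lemma blocks_independent: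
  "sorted_wrt (\<lambda>b c. \<not> (hd b \<in> set c \<and> hd (tl b) \<in> set c)) blocks"
  by (simp only: evaluate)

lemma good_points:
  "good_point 0" "good_point 13" "good_point 26" "good_point 39" "good_point 52" "good_point 65"
  by (simp_all only: evaluate)

text \<open>If exactly 4 of at least 13 blocks pass through the point, at least 9 avoid it. The
  thresholds 8, 7 and 10 for 5, 6 and 3 blocks arise in the same way.\<close>

lemma four_blocks:
  "list_all (spans_exceptional 9) (candidates 9 4 0)"
  "list_all (spans_exceptional 9) (candidates 9 4 13)"
  "list_all (spans_exceptional 9) (candidates 9 4 26)"
  "list_all (spans_exceptional 9) (candidates 9 4 39)"
  "list_all (spans_exceptional 9) (candidates 9 4 52)"
  "list_all (spans_exceptional 9) (candidates 9 4 65)"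
  by (simp_all only: evaluate)

lemma five_blocks:
  "list_all (spans_exceptional 8) (candidates 8 5 0)"
  "list_all (spans_exceptional 8) (candidates 8 5 13)"
  "list_all (spans_exceptional 8) (candidates 8 5 26)"
  "list_all (spans_exceptional 8) (candidates 8 5 39)"
  "list_all (spans_exceptional 8) (candidates 8 5 52)"
  "list_all (spans_exceptional 8) (candidates 8 5 65)"
  by (simp_all only: evaluate)

lemma six_blocks:
  "list_all (spans_exceptional 7) (candidates 7 6 0)"
  "list_all (spans_exceptional 7) (candidates 7 6 13)"
  "list_all (spans_exceptional 7) (candidates 7 6 26)"
  "list_all (spans_exceptional 7) (candidates 7 6 39)"
  "list_all (spans_exceptional 7) (candidates 7 6 52)"
  "list_all (spans_exceptional 7) (candidates 7 6 65)"
  by (simp_all only: evaluate)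

text \<open>The representatives 39 and 52 have to be left out: \<open>orbit_clique\<close> has
  degree 3 at every point of their orbits, so its blocks there are not starved.\<close>

lemma three_blocks:
  "list_all (starved 0) (candidates 10 3 0)"
  "list_all (starved 13) (candidates 10 3 13)"
  "list_all (starved 26) (candidates 10 3 26)"
  "list_all (starved 65) (candidates 10 3 65)"
  by (simp_all only: evaluate)

text \<open>The blocks inside the last two copies are those of \<open>orbit_clique\<close>. This
  settles the cliques that \<open>three_blocks\<close> confines to these copies.\<close>

lemma blocks_cases:
  "list_all (\<lambda>b. list_ex (\<lambda>q. q < 39 \<or> q = 65) b \<or> b \<in> set (hd cliques)) blocks"
  by (simp only: evaluate)

lemma cliques_subset: "list_all (list_all (\<lambda>b. b \<in> set blocks)) cliques"
  by (simp only: evaluate)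

lemma cliques_meet: "list_all (sorted_wrt (\<lambda>b c. b \<noteq> c \<and> meet b c)) cliques"
  by (simp only: evaluate)

text \<open>A point common to all blocks would lie on the first one, so only the points of
  \<open>hd C\<close> need testing.\<close>

lemma cliques_without_center:
  "list_all (\<lambda>C. list_all (\<lambda>p. list_ex (\<lambda>b. p \<notin> set b) C) (hd C)) cliques"
  by (simp only: evaluate)

lemma cliques_differ: "sorted_wrt (\<lambda>C D. list_ex (\<lambda>b. b \<notin> set D) C) cliques"
  by (simp only: evaluate)

section \<open>Classification of the large cliques\<close>

lemma sorted_wrt_imp_distinct_map:
  assumes "sorted_wrt R xs" "\<And>x y. x \<in> set xs \<Longrightarrow> y \<in> set xs \<Longrightarrow> R x y \<Longrightarrow> f x \<noteq> f y"
  shows "distinct (map f xs)"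
  using assms by (induction xs) auto

lemma sorted_wrt_imp_pairwise:
  assumes "sorted_wrt R xs" "x \<in> set xs" "y \<in> set xs" "x \<noteq> y"
  shows "R x y \<or> R y x"
  using assms by (induction xs) auto

lemma length_block: "b \<in> set blocks \<Longrightarrow> length b = 6"
  using base_blocks_props by (auto simp: blocks_def list_all_iff)

text \<open>A block has six entries, so its first two exist; not lying together on a later block,
  they tell the two point sets apart.\<close>

lemma distinct_blocks: "distinct (map set blocks)"
proof (rule sorted_wrt_imp_distinct_map[OF blocks_independent])
  fix b c
  assume "b \<in> set blocks" "\<not> (hd b \<in> set c \<and> hd (tl b) \<in> set c)"
  moreover obtain x y zs where "b = x # y # zs"
    using length_block[OF calculation(1)] by (auto simp: numeral_eq_Suc length_Suc_conv)
  ultimately show "set b \<noteq> set c"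
    by auto
qed

lemma inj_on_set_blocks: "inj_on set (set blocks)"
  using distinct_blocks by (simp add: distinct_map)

lemma card_lines: "card lines = 143"
proof -
  have "lines = set (map set blocks)"
    by (simp add: lines_def)
  moreover have "length blocks = 143"
    by (simp add: blocks_def base_blocks_def)
  ultimately show ?thesis
    using distinct_card[OF distinct_blocks] by simp
qed

lemma finite_lines: "finite lines"
  by (simp add: lines_def)

lemma good_point_unique:
  assumes "good_point p" "q < 66" "q \<noteq> p"
  shows "\<exists>!b. b \<in> lines \<and> p \<in> b \<and> q \<in> b"
proof -
  let ?bs = "filter (\<lambda>b. q \<in> set b) (filter (\<lambda>b. p \<in> set b) blocks)"
  have "covered_once (filter (\<lambda>b. p \<in> set b) blocks) q"
    using assms by (auto simp: good_point_def list_all_iff)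
  then have "length ?bs = 1"
    by (simp add: covered_once_def at_least_iff)
  then obtain b where "?bs = [b]"
    by (auto simp: length_Suc_conv)
  then have "set ?bs = {b}"
    by simp
  then have b: "c \<in> set blocks \<and> p \<in> set c \<and> q \<in> set c \<longleftrightarrow> c = b" for c
    by (simp add: set_eq_iff)
  show ?thesis
  proof (rule ex1I[of _ "set b"])
    show "set b \<in> lines \<and> p \<in> set b \<and> q \<in> set b"
      using b[of b] by (simp add: lines_def)
  next
    fix c
    assume "c \<in> lines \<and> p \<in> c \<and> q \<in> c"
    then obtain d where "d \<in> set blocks \<and> p \<in> set d \<and> q \<in> set d" "c = set d"
      by (auto simp: lines_def)
    then show "c = set b"
      by (simp only: b)
  qed
qed

definition representatives :: "nat set" where
  "representatives = {0, 13, 26, 39, 52, 65}"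

definition orbit_representative :: "nat \<Rightarrow> nat" where
  "orbit_representative p = (if p = 65 then 65 else 13 * (p div 13))"

text \<open>The shift lies between 1 and 13 and carries \<open>p\<close> to residue 0; a shift by 13
  acts trivially.\<close>

lemma translate_to_representative: "translate (13 - p mod 13) p = orbit_representative p"
proof -
  define d r where "d = p div 13" and "r = p mod 13"
  have "p = 13 * d + r" "r < 13"
    by (simp_all add: d_def r_def)
  then have "p + (13 - r) = 13 * (d + 1)"
    by simp
  then have "(p + (13 - p mod 13)) mod 13 = 0"
    by (simp add: r_def)
  then show ?thesis
    by (simp add: translate_def orbit_representative_def)
qed

lemma orbit_representative:
  assumes "p < 66"
  shows "orbit_representative p \<in> representatives"
proof (cases "p = 65")
  case False
  then have "p div 13 < 5"
    using assms by (simp add: less_mult_imp_div_less)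
  then have "p div 13 = 0 \<or> p div 13 = 1 \<or> p div 13 = 2 \<or> p div 13 = 3 \<or> p div 13 = 4"
    by linarith
  then show ?thesis
    using False by (auto simp: orbit_representative_def representatives_def)
qed (simp add: orbit_representative_def representatives_def)

text \<open>Translate the pair so that \<open>x\<close> becomes a representative, where
  \<open>good_points\<close> gives the unique block, and translate that block back.\<close>

lemma lines_design: "design_2_1 66 6 {..<66} lines"
  unfolding design_2_1_def
proof (intro conjI ballI impI)
  fix x y :: nat
  assume xy: "x \<in> {..<66}" "y \<in> {..<66}" "x \<noteq> y"
  define i where "i = 13 - x mod 13"
  have "good_point (translate i x)"
    using orbit_representative[of x] translate_to_representative[of x] xy good_points
    by (auto simp: i_def representatives_def)
  moreover have "translate i y \<noteq> translate i x" "translate i y < 66"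
    using xy inj_on_translate[of i] translate_less[of y i] by (auto simp: inj_on_def)
  ultimately have "\<exists>!b. b \<in> lines \<and> translate i x \<in> b \<and> translate i y \<in> b"
    by (intro good_point_unique)
  then obtain b where b: "b \<in> lines" "translate i x \<in> b" "translate i y \<in> b"
    and uniq: "\<And>c. c \<in> lines \<Longrightarrow> translate i x \<in> c \<Longrightarrow> translate i y \<in> c \<Longrightarrow> c = b"
    by blast
  show "\<exists>!b. b \<in> lines \<and> x \<in> b \<and> y \<in> b"
  proof (rule ex1I[of _ "translate (12 * i) ` b"])
    show "translate (12 * i) ` b \<in> lines \<and> x \<in> translate (12 * i) ` b \<and> y \<in> translate (12 * i) ` b"
      using translate_line[OF b(1)] xy
        imageI[OF b(2), of "translate (12 * i)"] imageI[OF b(3), of "translate (12 * i)"]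
      by (simp add: translate_inverse)
  next
    fix c
    assume c: "c \<in> lines \<and> x \<in> c \<and> y \<in> c"
    then have "translate i ` c = b"
      by (intro uniq translate_line imageI) auto
    then show "c = translate (12 * i) ` b"
      using image_translate_inverse[of c i] line(1) c by auto
  qed
qed (use line in auto)

lemma card_pencil: "p < 66 \<Longrightarrow> card {b \<in> lines. p \<in> b} = 13"
  using design_replication[OF lines_design, of p] by simp

section \<open>From the search to cliques\<close>

lemma clique_finite: "clique (block_graph lines) K \<Longrightarrow> finite K"
  using finite_lines by (auto simp: clique_block_graph_iff intro: finite_subset[of K lines])

text \<open>Applies \<open>search_complete\<close> to the blocks of \<open>K\<close> through
  \<open>p\<close> and those off \<open>p\<close>. \<open>K'\<close> represents \<open>K\<close> by
  lists; cardinalities agree because \<open>set\<close> is injective on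
  \<open>blocks\<close>.\<close>

lemma candidates_complete:
  assumes K: "clique (block_graph lines) K" and K': "K' = {b \<in> set blocks. set b \<in> K}"
    and k: "k = card {b \<in> K. p \<in> b}" and m: "0 < m" "m + k \<le> card K"
  shows "\<exists>T F. (T, F) \<in> set (candidates m k p) \<and> set T = {b \<in> K'. p \<in> set b} \<and>
    {b \<in> K'. p \<notin> set b} \<subseteq> set F \<and> m \<le> card {b \<in> K'. p \<notin> set b}"
proof -
  let ?T = "{b \<in> K'. p \<in> set b}" and ?E = "{b \<in> K'. p \<notin> set b}"
  have fin: "finite K"
    using K by (rule clique_finite)
  have sub: "K' \<subseteq> set blocks" and img: "set ` K' = K"
    using K by (auto simp: K' clique_block_graph_iff lines_def)
  have inj: "inj_on set A" if "A \<subseteq> K'" for A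
    using inj_on_set_blocks that sub by (auto intro: inj_on_subset)
  have "set ` ?T = {b \<in> K. p \<in> b}" "set ` ?E = {b \<in> K. p \<notin> b}"
    using img by auto
  then have card: "card ?T = card {b \<in> K. p \<in> b}" "card ?E = card {b \<in> K. p \<notin> b}"
    using card_image[OF inj[of ?T]] card_image[OF inj[of ?E]] by auto
  have "{b \<in> K. p \<notin> b} = K - {b \<in> K. p \<in> b}"
    by auto
  then have "card {b \<in> K. p \<notin> b} = card K - k"
    using fin by (simp add: card_Diff_subset k)
  then have "m \<le> card ?E"
    using m card by simp
  moreover have "meet e t" if "t \<in> ?T" "e \<in> ?E" for t e
  proof -
    have "set t \<in> K" "set e \<in> K" "set e \<noteq> set t"
      using that img by auto
    then show ?thesis
      using K unfolding clique_block_graph_iff meet_def by blast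
  qed
  ultimately have "\<exists>T F. (T, F) \<in> set (candidates m k p) \<and> set T = ?T \<union> set [] \<and> ?E \<subseteq> set F"
    unfolding candidates_def using sub card(1) k m(1) by (intro search_complete) auto
  then show ?thesis
    using \<open>m \<le> card ?E\<close> by auto
qed

lemma cliques_length: "C \<in> set cliques \<Longrightarrow> length C = 13"
  by (auto simp: cliques_def orbit_clique_def mixed_clique_def)

lemma clique_blocks: "C \<in> set cliques \<Longrightarrow> set C \<subseteq> set blocks"
  using cliques_subset by (auto simp: list_all_iff)

lemma exceptional_clique:
  assumes "K \<in> exceptional"
  shows "clique (block_graph lines) K" "card K = 13"
proof -
  obtain C where C: "C \<in> set cliques" and K: "K = set ` set C"
    using assms by (auto simp: exceptional_def)
  have sub: "set C \<subseteq> set blocks"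
    using C by (rule clique_blocks)
  have sorted: "sorted_wrt (\<lambda>b c. b \<noteq> c \<and> meet b c) C"
    using cliques_meet C by (auto simp: list_all_iff)
  have "distinct (map set C)"
    using inj_on_set_blocks sub by (intro sorted_wrt_imp_distinct_map[OF sorted]) (auto simp: inj_on_def)
  then show "card K = 13"
    using distinct_card[of "map set C"] C by (simp add: K cliques_length)
  have "meet b c" if "b \<in> set C" "c \<in> set C" "b \<noteq> c" for b c
    using sorted_wrt_imp_pairwise[OF sorted that] by (auto simp: meet_def)
  then show "clique (block_graph lines) K"
    using sub by (auto simp: K clique_block_graph_iff lines_def meet_def)
qed

lemma exceptional_maximal:
  assumes "K \<subseteq> L" "L \<in> exceptional" "13 \<le> card K"
  shows "K \<in> exceptional"
proof -
  have "K = L"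
    using assms exceptional_clique[OF assms(2)] clique_finite by (intro card_seteq) auto
  then show ?thesis
    using assms by simp
qed

lemma degree_4_to_6_at_representative:
  assumes K: "clique (block_graph lines) K" "13 \<le> card K" and p: "p \<in> representatives"
    and k: "k = card {b \<in> K. p \<in> b}" "k \<in> {4, 5, 6}"
  shows "K \<in> exceptional"
proof -
  define K' where "K' = {b \<in> set blocks. set b \<in> K}"
  define m where "m = 13 - k"
  let ?E = "{b \<in> K'. p \<notin> set b}"
  have m: "0 < m" "m + k = 13"
    using k by (auto simp: m_def)
  have img: "set ` K' = K"
    using K by (auto simp: K'_def clique_block_graph_iff lines_def)
  obtain T F where TF: "(T, F) \<in> set (candidates m k p)" and T: "set T = {b \<in> K'. p \<in> set b}"
    and F: "?E \<subseteq> set F" and E: "m \<le> card ?E"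
    using candidates_complete[OF K(1) K'_def k(1) m(1)] m(2) K(2) by auto
  have "list_all (spans_exceptional m) (candidates m k p)"
    using p k(2) unfolding m_def representatives_def
    by (elim insertE emptyE) (simp_all add: four_blocks five_blocks six_blocks)
  then have ok: "spans_exceptional m (T, F)"
    using TF by (auto simp: list_all_iff)
  have core: "?E \<subseteq> set (core m F)"
  proof
    fix e
    assume e: "e \<in> ?E"
    have "meet e f" if "f \<in> ?E" for f
    \<comment> \<open>A block is nonempty and so meets itself; hence the threshold in
      \<open>core\<close> is \<open>m\<close> and not \<open>m - 1\<close>.\<close>
    proof (cases "set e = set f")
      case True
      then show ?thesis
        using e length_block[of e] by (auto simp: meet_def K'_def)
    next
      case False
      then show ?thesis
        using K(1) e that by (auto simp: K'_def clique_block_graph_iff meet_def)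
    qed
    then have "?E \<subseteq> set (filter (meet e) F)"
      using F by auto
    then have "card ?E \<le> card (set (filter (meet e) F))"
      by (intro card_mono) auto
    also have "\<dots> \<le> length (filter (meet e) F)"
      by (rule card_length)
    finally have "at_least m (filter (meet e) F)"
      using E by (simp add: at_least_iff)
    moreover have "e \<in> set F"
      using F e by blast
    ultimately show "e \<in> set (core m F)"
      by (simp add: core_def)
  qed
  then have le: "card ?E \<le> card (set (core m F))"
    by (intro card_mono) auto
  moreover have len: "card (set (core m F)) \<le> length (core m F)"
    by (rule card_length)
  ultimately have "at_least m (core m F)"
    using E by (simp add: at_least_iff)
  \<comment> \<open>The core is large enough to exclude the first alternative of
    \<open>spans_exceptional\<close>.\<close>
  with ok have "list_ex (\<lambda>C. list_all (\<lambda>b. b \<in> set C) (T @ core m F)) cliques"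
    by simp
  then obtain C where C: "C \<in> set cliques" "set T \<union> set (core m F) \<subseteq> set C"
    by (auto simp: list_ex_iff list_all_iff)
  have "K' \<subseteq> set C"
    using C(2) T core by auto
  then have "K \<subseteq> set ` set C"
    using img by auto
  moreover have "set ` set C \<in> exceptional"
    using C(1) by (auto simp: exceptional_def)
  ultimately show ?thesis
    using K(2) by (rule exceptional_maximal)
qed

lemma degree_3_at_representative:
  assumes K: "clique (block_graph lines) K" "card K = 13" and p: "p \<in> {0, 13, 26, 65}"
    and deg: "\<And>q. q \<in> \<Union>K \<Longrightarrow> card {b \<in> K. q \<in> b} = 3"
  shows "p \<notin> \<Union>K"
proof
  assume "p \<in> \<Union>K"
  define K' where "K' = {b \<in> set blocks. set b \<in> K}"
  have img: "set ` K' = K" and sub: "K \<subseteq> lines"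
    using K by (auto simp: K'_def clique_block_graph_iff lines_def)
  obtain T F where TF: "(T, F) \<in> set (candidates 10 3 p)" and T: "set T = {b \<in> K'. p \<in> set b}"
    and F: "{b \<in> K'. p \<notin> set b} \<subseteq> set F"
    using candidates_complete[OF K(1) K'_def deg[OF \<open>p \<in> \<Union>K\<close>, symmetric], of 10] K(2) by auto
  have "list_all (starved p) (candidates 10 3 p)"
    using three_blocks p by auto
  then have "starved p (T, F)"
    using TF by (auto simp: list_all_iff)
  then obtain t q where t: "t \<in> set T" "q \<in> set t" "q \<noteq> p"
    and few: "\<not> 2 \<le> length (filter (\<lambda>b. q \<in> set b) F)"
    by (auto simp: list_ex_iff at_least_iff)
  have tK: "set t \<in> K" "p \<in> set t"
    using t T by (auto simp: K'_def)
  \<comment> \<open>The block \<open>t\<close> is the only one through both \<open>p\<close> and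
    \<open>q\<close>, so the other blocks of \<open>K\<close> through \<open>q\<close> avoid
    \<open>p\<close> and appear in \<open>F\<close>.\<close>
  have "{b \<in> K. q \<in> b} - {set t} \<subseteq> set ` set (filter (\<lambda>b. q \<in> set b) F)"
  proof
    fix b
    assume b: "b \<in> {b \<in> K. q \<in> b} - {set t}"
    then obtain c where c: "c \<in> K'" "b = set c"
      using img by auto
    have "b \<in> lines" "set t \<in> lines" "b \<noteq> set t" "q \<in> b"
      using b tK sub by auto
    then have "p \<notin> b"
      using design_block_inter[OF lines_design, of b "set t" p q] t tK by blast
    then show "b \<in> set ` set (filter (\<lambda>b. q \<in> set b) F)"
      using F b c by auto
  qed
  then have "card ({b \<in> K. q \<in> b} - {set t}) \<le> card (set (map set (filter (\<lambda>b. q \<in> set b) F)))"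
    by (intro card_mono) simp_all
  also have "\<dots> \<le> length (map set (filter (\<lambda>b. q \<in> set b) F))"
    by (rule card_length)
  finally have "card ({b \<in> K. q \<in> b} - {set t}) \<le> length (filter (\<lambda>b. q \<in> set b) F)"
    by simp
  moreover have "card {b \<in> K. q \<in> b} = 3"
    using deg t(2) tK(1) by blast
  then have "card ({b \<in> K. q \<in> b} - {set t}) = 2"
    using t(2) tK(1) by (simp add: card_Diff_singleton)
  ultimately show False
    using few by simp
qed

section \<open>Reduction to orbit representatives and the case distinction by degree\<close>

lemma translate_clique:
  assumes K: "clique (block_graph lines) K" and p: "p < 66"
  shows "clique (block_graph lines) (image (translate i) ` K)"
    and "card (image (translate i) ` K) = card K"
    and "card {b \<in> image (translate i) ` K. translate i p \<in> b} = card {b \<in> K. p \<in> b}"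
    and "image (translate (12 * i)) ` image (translate i) ` K = K"
proof -
  have sub: "K \<subseteq> lines" and pts: "\<And>b. b \<in> K \<Longrightarrow> b \<subseteq> {..<66}"
    using K line(1) by (auto simp: clique_block_graph_iff)
  have inj: "inj_on (image (translate i)) A" if "A \<subseteq> K" for A
  proof (rule inj_on_inverseI)
    fix b
    assume "b \<in> A"
    then show "translate (12 * i) ` translate i ` b = b"
      using that pts by (intro image_translate_inverse) blast
  qed
  show "clique (block_graph lines) (image (translate i) ` K)"
    using K translate_line unfolding clique_block_graph_iff by blast
  show "card (image (translate i) ` K) = card K"
    using inj by (simp add: card_image)
  have "translate i p \<in> translate i ` b \<longleftrightarrow> p \<in> b" if "b \<in> K" for b
    using inj_on_image_mem_iff[OF inj_on_translate, of p b] pts[OF that] p by auto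
  then have "{b \<in> image (translate i) ` K. translate i p \<in> b} = image (translate i) ` {b \<in> K. p \<in> b}"
    by auto
  then show "card {b \<in> image (translate i) ` K. translate i p \<in> b} = card {b \<in> K. p \<in> b}"
    using inj[of "{b \<in> K. p \<in> b}"] by (simp add: card_image)
  show "image (translate (12 * i)) ` image (translate i) ` K = K"
    using pts image_translate_inverse by (simp add: image_image cong: image_cong)
qed

text \<open>Move \<open>p\<close> to its representative, apply the check there, and move back;
  \<open>exceptional\<close> is closed under translation.\<close>

lemma degree_4_to_6:
  assumes K: "clique (block_graph lines) K" "13 \<le> card K" and p: "p < 66"
    and k: "card {b \<in> K. p \<in> b} \<in> {4, 5, 6}"
  shows "K \<in> exceptional"
proof -
  define i where "i = 13 - p mod 13"
  note K' = translate_clique[OF K(1) p, of i]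
  have "image (translate i) ` K \<in> exceptional"
  proof (rule degree_4_to_6_at_representative[OF K'(1)])
    show "translate i p \<in> representatives"
      using orbit_representative[OF p] by (simp add: i_def translate_to_representative)
  qed (use K'(2,3) K(2) k in auto)
  then have "image (translate (12 * i)) ` image (translate i) ` K \<in> exceptional"
    by (rule translate_exceptional)
  then show ?thesis
    by (simp only: K'(4))
qed

lemma degree_3:
  assumes K: "clique (block_graph lines) K" "card K = 13" and p: "p < 39 \<or> p = 65"
    and deg: "\<And>q. q \<in> \<Union>K \<Longrightarrow> card {b \<in> K. q \<in> b} = 3"
  shows "p \<notin> \<Union>K"
proof
  assume "p \<in> \<Union>K"
  define i where "i = 13 - p mod 13"
  have pts: "q < 66" if "q \<in> \<Union>K" for q
    using that K(1) line(1) by (auto simp: clique_block_graph_iff)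
  have "p div 13 < 3" if "p \<noteq> 65"
    using that p by (simp add: less_mult_imp_div_less)
  then have "p div 13 = 0 \<or> p div 13 = 1 \<or> p div 13 = 2" if "p \<noteq> 65"
    using that by linarith
  then have "translate i p \<in> {0, 13, 26, 65}"
    unfolding i_def translate_to_representative orbit_representative_def by auto
  moreover have "card {b \<in> image (translate i) ` K. q \<in> b} = 3" if q: "q \<in> \<Union>(image (translate i) ` K)" for q
  proof -
    obtain r where r: "r \<in> \<Union>K" "q = translate i r"
      using q by auto
    show ?thesis
      unfolding r(2) translate_clique(3)[OF K(1) pts[OF r(1)]] by (rule deg[OF r(1)])
  qed
  ultimately have "translate i p \<notin> \<Union>(image (translate i) ` K)"
    using translate_clique(1,2)[OF K(1) pts[OF \<open>p \<in> \<Union>K\<close>], of i] K(2)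
    by (intro degree_3_at_representative) auto
  then show False
    using \<open>p \<in> \<Union>K\<close> by auto
qed

lemma large_clique_cases:
  assumes K: "clique (block_graph lines) K" "13 \<le> card K"
  shows "(\<exists>p<66. K = {b \<in> lines. p \<in> b}) \<or> K \<in> exceptional"
proof -
  have fin: "finite K" and sub: "K \<subseteq> lines"
    using clique_finite K by (auto simp: clique_block_graph_iff)
  consider (high) p where "p < 66" "6 < card {b \<in> K. p \<in> b}"
    | (middle) p where "p < 66" "card {b \<in> K. p \<in> b} \<in> {4, 5, 6}"
    | (low) "\<forall>p<66. card {b \<in> K. p \<in> b} \<le> 3"
  proof (cases "\<forall>p<66. card {b \<in> K. p \<in> b} \<le> 3")
    case False
    then obtain p where p: "p < 66" "3 < card {b \<in> K. p \<in> b}"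
      by (auto simp: not_le)
    then have "6 < card {b \<in> K. p \<in> b} \<or> card {b \<in> K. p \<in> b} \<in> {4, 5, 6}"
      by auto
    then show ?thesis
      using that(1,2) p(1) by blast
  qed (use that(3) in blast)
  then show ?thesis
  proof cases
    case high
    then have "K \<subseteq> {b \<in> lines. p \<in> b}"
      by (intro clique_degree_gt_imp_pencil[OF lines_design K(1) fin])
    \<comment> \<open>All 13 blocks through \<open>p\<close> are then needed to reach the size of
      \<open>K\<close>.\<close>
    moreover have "card {b \<in> lines. p \<in> b} \<le> card K"
      using card_pencil high K(2) by simp
    ultimately have "K = {b \<in> lines. p \<in> b}"
      using finite_lines by (intro card_seteq) auto
    then show ?thesis
      using high by blast
  next
    case middle
    then show ?thesis
      using degree_4_to_6[OF K] by blast
  next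
    case low
    \<comment> \<open>Six degrees of at most 3 add up to \<open>card K + 5\<close>, which is at
      least 18, so equality holds throughout.\<close>
    have bound: "card K + 5 \<le> 18 \<and> (\<forall>q\<in>b. card {c \<in> K. q \<in> c} = 3)" if b: "b \<in> K" for b
    proof -
      have pts: "b \<subseteq> {..<66}" "card b = 6" "finite b"
        using design_block[OF lines_design] sub b by blast+
      have sum: "(\<Sum>q\<in>b. card {c \<in> K. q \<in> c}) = card K + 5"
        using clique_degree_sum[OF lines_design K(1) fin b] by simp
      have le: "card {c \<in> K. q \<in> c} \<le> 3" if "q \<in> b" for q
        using low pts that by auto
      have "(\<Sum>q\<in>b. card {c \<in> K. q \<in> c}) \<le> (\<Sum>q\<in>b. 3)"
        using le by (rule sum_mono)
      then have K18: "card K + 5 \<le> 18"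
        using sum pts by simp
      moreover have "card {c \<in> K. q \<in> c} = 3" if q: "q \<in> b" for q
      proof (rule ccontr)
        assume "card {c \<in> K. q \<in> c} \<noteq> 3"
        with le[OF q] have "card {c \<in> K. q \<in> c} < 3"
          by simp
        then have "(\<Sum>q\<in>b. card {c \<in> K. q \<in> c}) < (\<Sum>q\<in>b. 3)"
          using le q pts by (intro sum_strict_mono_ex1) auto
        then show False
          using sum pts K(2) by simp
      qed
      ultimately show ?thesis
        by blast
    qed
    have "K \<noteq> {}"
      using K(2) by auto
    then obtain b where "b \<in> K"
      by blast
    then have K13: "card K = 13"
      using bound[of b] K(2) by simp
    have none: "p \<notin> \<Union>K" if "p < 39 \<or> p = 65" for p
      using bound by (intro degree_3[OF K(1) K13 that]) blast
    \<comment> \<open>No block of \<open>K\<close> has a point in the first three copies or at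
      infinity, which leaves only the blocks of the orbit clique.\<close>
    have "K \<subseteq> set ` set (hd cliques)"
    proof
      fix b
      assume "b \<in> K"
      then obtain c where c: "c \<in> set blocks" "b = set c"
        using sub by (auto simp: lines_def)
      have "\<not> list_ex (\<lambda>q. q < 39 \<or> q = 65) c"
        using none \<open>b \<in> K\<close> c by (auto simp: list_ex_iff)
      then show "b \<in> set ` set (hd cliques)"
        using blocks_cases c by (auto simp: list_all_iff)
    qed
    have "set ` set (hd cliques) \<in> exceptional"
      by (auto simp: exceptional_def cliques_def)
    with \<open>K \<subseteq> set ` set (hd cliques)\<close> have "K \<in> exceptional"
      using K(2) by (rule exceptional_maximal)
    then show ?thesis
      by blast
  qed
qed

section \<open>The maximum cliques and their number\<close>

lemma pencil_clique: "clique (block_graph lines) {b \<in> lines. p \<in> b}"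
  by (auto simp: clique_block_graph_iff)

text \<open>Both families consist of cliques with 13 blocks, and every clique with at least 13
  blocks belongs to one of them, so 13 is the maximum.\<close>

lemma maximum_clique_iff:
  "maximum_clique (block_graph lines) K \<longleftrightarrow> (\<exists>p<66. K = {b \<in> lines. p \<in> b}) \<or> K \<in> exceptional"
proof
  assume max: "maximum_clique (block_graph lines) K"
  then have "card {b \<in> lines. 0 \<in> b} \<le> card K"
    using pencil_clique unfolding maximum_clique_def by blast
  then show "(\<exists>p<66. K = {b \<in> lines. p \<in> b}) \<or> K \<in> exceptional"
    using max card_pencil[of 0] by (intro large_clique_cases) (simp_all add: maximum_clique_def)
next
  have card13: "clique (block_graph lines) L \<and> card L = 13"
    if "(\<exists>p<66. L = {b \<in> lines. p \<in> b}) \<or> L \<in> exceptional" for L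
    using that
  proof
    assume "L \<in> exceptional"
    then show ?thesis
      using exceptional_clique by blast
  next
    assume "\<exists>p<66. L = {b \<in> lines. p \<in> b}"
    then obtain p where "p < 66" "L = {b \<in> lines. p \<in> b}"
      by blast
    then show ?thesis
      using pencil_clique[of p] card_pencil[of p] by simp
  qed
  have bound: "finite L \<and> card L \<le> 13" if L: "clique (block_graph lines) L" for L
  proof (cases "13 \<le> card L")
    case True
    then show ?thesis
      using card13[OF large_clique_cases[OF L]] clique_finite[OF L] by simp
  qed (use clique_finite[OF L] in simp)
  assume "(\<exists>p<66. K = {b \<in> lines. p \<in> b}) \<or> K \<in> exceptional"
  then have "clique (block_graph lines) K" "card K = 13"
    using card13 by blast+
  then show "maximum_clique (block_graph lines) K"
    unfolding maximum_clique_def using bound clique_finite by simp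
qed

lemma exceptional_not_pencil:
  assumes "K \<in> exceptional"
  shows "K \<noteq> {b \<in> lines. p \<in> b}"
proof
  assume pencil: "K = {b \<in> lines. p \<in> b}"
  obtain C where C: "C \<in> set cliques" and K: "K = set ` set C"
    using assms by (auto simp: exceptional_def)
  have all: "p \<in> set b" if "b \<in> set C" for b
  proof -
    have "set b \<in> K"
      using that by (simp add: K)
    then show ?thesis
      by (simp add: pencil)
  qed
  have "hd C \<in> set C"
    using cliques_length[OF C] by (cases C) simp_all
  then have "p \<in> set (hd C)"
    by (rule all)
  then obtain b where "b \<in> set C" "p \<notin> set b"
    using cliques_without_center C unfolding list_all_iff list_ex_iff by blast
  then show False
    using all by blast
qed

lemma card_exceptional: "card exceptional = 14"
proof -
  have "distinct (map (\<lambda>C. set ` set C) cliques)"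
  proof (rule sorted_wrt_imp_distinct_map[OF cliques_differ])
    fix C D
    assume CD: "C \<in> set cliques" "D \<in> set cliques" "list_ex (\<lambda>b. b \<notin> set D) C"
    then have "set C \<noteq> set D"
      by (auto simp: list_ex_iff)
    then show "set ` set C \<noteq> set ` set D"
      using inj_on_image_eq_iff[OF inj_on_set_blocks CD(1,2)[THEN clique_blocks]] by simp
  qed
  moreover have "length cliques = 14"
    by (simp add: cliques_def)
  ultimately show ?thesis
    using distinct_card[of "map (\<lambda>C. set ` set C) cliques"] by (simp add: exceptional_def)
qed

text \<open>Two distinct points share at most one block, whereas 13 blocks pass through each
  point.\<close>

lemma inj_on_pencil: "inj_on (\<lambda>p. {b \<in> lines. p \<in> b}) {..<66}"
proof (rule inj_onI, rule ccontr)
  fix p q :: nat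
  assume pq: "p \<in> {..<66}" "q \<in> {..<66}"
    and eq: "{b \<in> lines. p \<in> b} = {b \<in> lines. q \<in> b}" and neq: "p \<noteq> q"
  have "b = c" if bc: "b \<in> {b \<in> lines. p \<in> b}" "c \<in> {b \<in> lines. p \<in> b}" for b c
  proof -
    have "q \<in> b" "q \<in> c"
      using bc[unfolded eq] by simp_all
    then show ?thesis
      using design_block_inter[OF lines_design, of b c p q] bc neq by blast
  qed
  then have "card {b \<in> lines. p \<in> b} \<le> Suc 0"
    using finite_lines by (subst card_le_Suc0_iff_eq) simp_all
  then show False
    using card_pencil[of p] pq(1) by simp
qed

theorem theorem1p2:
  shows "\<exists>(P :: nat set) (B :: nat set set).
    design_2_1 66 6 P B \<and> card B = 143 \<and>
    card {K. maximum_clique (block_graph B) K} = 80 \<and>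
    card {K. canonical_clique P B K} = 66 \<and>
    card {K. non_canonical_clique P B K} = 14 \<and>
    (\<forall>K. non_canonical_clique P B K \<longrightarrow> \<not> has_design_structure 6 K)"
proof (intro exI conjI allI impI)
  let ?pencils = "(\<lambda>p. {b \<in> lines. p \<in> b}) ` {..<66}"
  show "design_2_1 66 6 {..<66} lines"
    by (rule lines_design)
  show "card lines = 143"
    by (rule card_lines)
  have canonical: "canonical_clique {..<66} lines K \<longleftrightarrow> K \<in> ?pencils" for K
    by (auto simp: canonical_clique_def maximum_clique_iff)
  have non_canonical: "non_canonical_clique {..<66} lines K \<longleftrightarrow> K \<in> exceptional" for K
    using exceptional_not_pencil by (auto simp: non_canonical_clique_def canonical maximum_clique_iff)
  have pencils: "card ?pencils = 66"
    using inj_on_pencil by (simp add: card_image)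
  have "{K. maximum_clique (block_graph lines) K} = ?pencils \<union> exceptional"
    by (auto simp: maximum_clique_iff)
  moreover have "?pencils \<inter> exceptional = {}"
    using exceptional_not_pencil by auto
  moreover have "finite exceptional"
    by (simp add: exceptional_def)
  ultimately show "card {K. maximum_clique (block_graph lines) K} = 80"
    using pencils card_exceptional by (simp add: card_Un_disjoint)
  show "card {K. canonical_clique {..<66} lines K} = 66"
    using pencils by (simp add: canonical)
  show "card {K. non_canonical_clique {..<66} lines K} = 14"
    using card_exceptional by (simp add: non_canonical)
  show "\<not> has_design_structure 6 K" if "non_canonical_clique {..<66} lines K" for K
    using that exceptional_clique(2) by (intro no_design_with_13_blocks) (simp add: non_canonical)
qed

end
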